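(* For every integer $n\ge 1$, the zigzag map $\zeta^{\mathrm{alt}}:\mathcal{PT}(n)\to S_n$ on the alternative representation is equal to $\varphi\circ\Phi$; that is, $\zeta^{\mathrm{alt}}(T)=\varphi(\Phi(T))$ for all $T\in\mathcal{PT}(n)$.
   Context: Ferrers diagrams: a Ferrers diagram is a left-justified arrangement of square cells, possibly with empty rows; its length is the number of rows plus the number of columns. The steps of the south-east border are labeled $1,\dots,n$ from north-east to south-west ($n$ the length); a row gets the label of its south step and a column the label of its west step. Equivalently, a diagram of length $n$ is a splitting of $\{1,\dots,n\}$ into row labels and column labels; rows are listed top to bottom in increasing order of label, columns left to right in decreasing order of label, and there is a cell in Row $r$ and Column $c$ exactly when $r<c$. Permutation tableaux: $\mathcal{PT}(n)$ is the set of Ferrers diagrams of length $n$ with a $0,1$-filling of the cells such that (1) each column has at least one $1$; (2) there is no $0$ having both a $1$ above it in the same column and a $1$ to the left of it in the same row. A $0$ is restricted if it has a $1$ above it in the same column; a row is unrestricted if it has no restricted $0$. Alternative representation of $T$: replace each topmost $1$ (topmost $1$ of its column) by $\uparrow$ and each rightmost restricted $0$ (rightmost restricted $0$ of its row) by $\leftarrow$, and erase all other entries. Each column then has exactly one $\uparrow$. The map $\Phi:\mathcal{PT}(n)\to S_n$ (values written as words): start with the word of the labels of the unrestricted rows of $T$ in increasing order. For each column, from the leftmost to the rightmost, say Column $c$: if the $\uparrow$ of Column $c$ is in Row $j$ and $i_1<\cdots<i_r$ are the labels of the rows containing a $\leftarrow$ in Column $c$, insert $i_1,\dots,i_r,c$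 in this order immediately before $j$ in the word. $\Phi(T)$ is the final word, a permutation of $\{1,\dots,n\}$. The map $\varphi$: for a word $w=w_1\cdots w_n$ of distinct integers, $w_i$ is a right-to-left minimum (RL-minimum) if $w_i<w_j$ for all $j>i$. If $w_{i_1},\dots,w_{i_k}$ with $i_1<\cdots<i_k=n$ are the RL-minima, $\varphi(w)$ is the permutation of $\{w_1,\dots,w_n\}$ with cycles $(w_1,\dots,w_{i_1}),(w_{i_1+1},\dots,w_{i_2}),\dots,(w_{i_{k-1}+1},\dots,w_{i_k})$, where a cycle $(a_1,\dots,a_p)$ sends $a_1\mapsto a_2\mapsto\cdots\mapsto a_p\mapsto a_1$. The zigzag map $\zeta^{\mathrm{alt}}$: in the alternative representation of $T$, for each label $i\in\{1,\dots,n\}$ consider the path that enters from the left end of Row $i$ travelling east (if $i$ is a row label) or from the top of Column $i$ travelling south (if $i$ is a column label), and that switches direction between east and south each time it meets a cell containing an arrow ($\uparrow$ or $\leftarrow$), until it exits the diagram through the south-east border, at the right end of a Row $j$ or the bottom of a Column $j$. Then $\zeta^{\mathrm{alt}}(T)$ is the permutation sending $i$ to $j$. *)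

theory Defs
  imports "HOL-Combinatorics.Combinatorics"
begin

text \<open>
  A filled Ferrers diagram is given by its sets of row labels and column labels, together with
  the set of the cells (row, column) that contain a 1; all other cells contain a 0.
  Rows are listed top to bottom by increasing label and columns left to right by decreasing
  label, so ``above'' means smaller row label and ``to the left'' means larger column label.
\<close>

record tableau =
  rows :: "nat set"
  cols :: "nat set"
  ones :: "(nat \<times> nat) set"

definition len :: "tableau \<Rightarrow> nat" where
  "len T = card (rows T) + card (cols T)"

definition cells :: "tableau \<Rightarrow> (nat \<times> nat) set" where
  "cells T = {(r, c). r \<in> rows T \<and> c \<in> cols T \<and> r < c}"

definition zeros :: "tableau \<Rightarrow> (nat \<times> nat) set" where
  "zeros T = cells T - ones T"

definition PT :: "nat \<Rightarrow> tableau set" where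
  "PT n = {T.
     rows T \<union> cols T = {1..n} \<and> rows T \<inter> cols T = {} \<and> ones T \<subseteq> cells T \<and>
     (\<forall>c\<in>cols T. \<exists>r. (r, c) \<in> ones T) \<and>
     (\<forall>(r, c)\<in>zeros T. \<not> ((\<exists>r'<r. (r', c) \<in> ones T) \<and> (\<exists>c'>c. (r, c') \<in> ones T)))}"

definition restricted :: "tableau \<Rightarrow> (nat \<times> nat) set" where
  "restricted T = {(r, c) \<in> zeros T. \<exists>r'<r. (r', c) \<in> ones T}"

definition unrestricted_rows :: "tableau \<Rightarrow> nat set" where
  "unrestricted_rows T = {r \<in> rows T. \<forall>c. (r, c) \<notin> restricted T}"

datatype arrow = Up_Arrow | Left_Arrow

definition alt_rep :: "tableau \<Rightarrow> nat \<Rightarrow> nat \<Rightarrow> arrow option" where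
  "alt_rep T r c =
     (if (r, c) \<in> ones T \<and> (\<forall>r'<r. (r', c) \<notin> ones T) then Some Up_Arrow
      else if (r, c) \<in> restricted T \<and> (\<forall>c'<c. (r, c') \<notin> restricted T) then Some Left_Arrow
      else None)"

text \<open>
  If \<open>j\<close> does not occur in \<open>w\<close>, then \<open>us\<close> is appended at the end; this never
  happens in the construction of \<open>Phi\<close> on a permutation tableau.
\<close>

definition insert_before :: "'a \<Rightarrow> 'a list \<Rightarrow> 'a list \<Rightarrow> 'a list" where
  "insert_before j us w = takeWhile (\<lambda>x. x \<noteq> j) w @ us @ dropWhile (\<lambda>x. x \<noteq> j) w"

definition insert_column :: "tableau \<Rightarrow> nat \<Rightarrow> nat list \<Rightarrow> nat list" where
  "insert_column T c w =
     insert_before (THE j. alt_rep T j c = Some Up_Arrow)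
       (sorted_list_of_set {i \<in> rows T. alt_rep T i c = Some Left_Arrow} @ [c]) w"

definition Phi :: "tableau \<Rightarrow> nat list" where
  "Phi T = fold (insert_column T) (rev (sorted_list_of_set (cols T)))
             (sorted_list_of_set (unrestricted_rows T))"

text \<open>The positions of the right-to-left minima, counted from 1.\<close>

definition rl_min_positions :: "'a::linorder list \<Rightarrow> nat list" where
  "rl_min_positions w =
     sorted_list_of_set
       {i \<in> {1..length w}. \<forall>j\<in>{i<..length w}. w ! (i - 1) < w ! (j - 1)}"

text \<open>
  With 1-based positions and \<open>i\<^sub>0 = 0\<close>, the block of the letters at the positions
  \<open>i\<^bsub>m-1\<^esub> + 1, \<dots>, i\<^bsub>m\<^esub>\<close> is \<open>drop i\<^bsub>m-1\<^esub> (take i\<^bsub>m\<^esub> w)\<close>.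
\<close>

definition rl_min_blocks :: "'a::linorder list \<Rightarrow> 'a list list" where
  "rl_min_blocks w =
     (let ps = rl_min_positions w in map (\<lambda>(a, b). drop a (take b w)) (zip (0 # ps) ps))"

text \<open>
  \<open>cycle_of_list [a\<^sub>1, \<dots>, a\<^sub>p]\<close> sends each entry to the next one and \<open>a\<^sub>p\<close> to \<open>a\<^sub>1\<close>.
  The blocks of a word of distinct letters are disjoint, so the order of composition is
  irrelevant. Elements not occurring in the word are fixed.
\<close>

definition phi :: "'a::linorder list \<Rightarrow> 'a \<Rightarrow> 'a" where
  "phi w = foldr (\<circ>) (map cycle_of_list (rl_min_blocks w)) id"

datatype heading = East | South

text \<open>
  \<open>travel T d r c\<close> is the label of the border step through which the path leaves the diagram
  when it departs from position \<open>(r, c)\<close> with heading \<open>d\<close>. The next cell to the east lies in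
  the column with the next smaller label, the next cell to the south in the row with the next
  larger label.
\<close>

function travel :: "tableau \<Rightarrow> heading \<Rightarrow> nat \<Rightarrow> nat \<Rightarrow> nat" where
  "travel T East r c =
     (let C = {c'. (r, c') \<in> cells T \<and> c' < c}; c' = Max C in
      if C = {} then r
      else travel T (if alt_rep T r c' = None then East else South) r c')"
| "travel T South r c =
     (let R = {r'. (r', c) \<in> cells T \<and> r < r'}; r' = Min R in
      if R = {} then c
      else travel T (if alt_rep T r' c = None then South else East) r' c)"
  by pat_completeness auto

termination
proof (relation "measure (\<lambda>(T, d, r, c). c - r)", goal_cases)
  case (2 T r c C c')
  have "finite C" using 2 by (auto intro: finite_subset[of _ "{..<c}"])
  then have "c' \<in> C" using 2 Max_in[of C] by blast
  then show ?case using 2 by (auto simp: cells_def)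
next
  case (3 T r c R r')
  have "finite R" using 3 by (auto simp: cells_def intro: finite_subset[of _ "{..<c}"])
  then have "r' \<in> R" using 3 Min_in[of R] by blast
  then show ?case using 3 by (auto simp: cells_def)
qed simp

text \<open>
  All labels of a permutation tableau \<open>T\<close> lie between 1 and \<open>len T\<close>, so a path that
  enters at the left end of a row departs from the fictitious column \<open>len T + 1\<close>, and a
  path that enters at the top of a column departs from the fictitious row 0.
  Numbers that are not labels are fixed.
\<close>

definition zigzag_alt :: "tableau \<Rightarrow> nat \<Rightarrow> nat" where
  "zigzag_alt T i =
     (if i \<in> rows T then travel T East i (len T + 1)
      else if i \<in> cols T then travel T South 0 i
      else i)"

end

theory Submission
  imports Defs
begin

text \<open>
  Both maps are built up one column at a time, from left to right, and a column changes both in the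
  same way. If Column \<open>c\<close> has its up-arrow in Row \<open>j\<close> and its left-arrows in the rows
  \<open>i\<^sub>1 < \<dots> < i\<^sub>r\<close>, then \<open>j < i\<^sub>1\<close>, and a path that would leave through one of the labels
  \<open>j, i\<^sub>1, \<dots>, i\<^sub>r\<close> is now diverted to the next one, from the last one to \<open>c\<close>, while the path
  entering at \<open>c\<close> is sent to \<open>j\<close>: the zigzag map is composed with the cycle
  \<open>(j, i\<^sub>1, \<dots>, i\<^sub>r, c)\<close>. On the other side, the letters \<open>i\<^sub>1, \<dots>, i\<^sub>r, c\<close> inserted before \<open>j\<close>
  all exceed \<open>j\<close>, so they leave the right-to-left minima unchanged and merely lengthen the cycle
  of \<open>j\<close>, which again is composition with \<open>(j, i\<^sub>1, \<dots>, i\<^sub>r, c)\<close>. The labels \<open>i\<^sub>1, \<dots>, i\<^sub>r, c\<close> are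
  fixed before this step because no cell to the left of a left-arrow contains an arrow.
\<close>

declare travel.simps [simp del]

section \<open>Cycles\<close>

text \<open>\<open>cycle_of_list\<close> is a product of transpositions of adjacent entries, so it
  can be cut at any entry, which then belongs to both factors.\<close>

lemma cycle_of_list_append_Cons:
  "cycle_of_list (xs @ y # ys) = cycle_of_list (xs @ [y]) \<circ> cycle_of_list (y # ys)"
proof (induction xs)
  case (Cons x xs)
  then show ?case by (cases xs) (simp_all add: comp_assoc)
qed simp

lemma cycle_of_list_append_commute:
  assumes "distinct (xs @ ys)"
  shows "cycle_of_list (xs @ ys) = cycle_of_list (ys @ xs)"
  using cycle_of_list_rotate_independent[OF assms, of "length xs"] by (simp add: rotate_append)

lemma cycle_of_list_next:
  assumes "distinct (xs @ x # y # ys)"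
  shows "cycle_of_list (xs @ x # y # ys) x = y"
proof -
  have "cycle_of_list (x # y # ys) x = y"
    using assms by (simp add: id_outside_supp)
  then show ?thesis
    using assms by (subst cycle_of_list_append_Cons) (auto simp: id_outside_supp simp del: cycle_of_list.simps)
qed

lemma cycle_of_list_last:
  assumes "distinct (x # xs @ [y])"
  shows "cycle_of_list (x # xs @ [y]) y = x"
  using cycle_of_list_next[of "[]" y x xs] cycle_of_list_append_commute[of "x # xs" "[y]"] assms
  by auto

lemma insert_before_split:
  assumes "j \<notin> set p"
  shows "insert_before j us (p @ j # q) = p @ us @ j # q"
  using assms unfolding insert_before_def
  by (subst takeWhile_append2 dropWhile_append2; auto)+

text \<open>Rotate the enlarged cycle so that it starts with \<open>us\<close> followed by
  \<open>j\<close>; cutting it at \<open>j\<close> splits off the cycle of \<open>us\<close> and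
  \<open>j\<close>.\<close>

lemma cycle_of_list_insert_before:
  assumes "distinct cs" "j \<in> set cs" "distinct us" "set us \<inter> set cs = {}"
  shows "cycle_of_list (insert_before j us cs) = cycle_of_list (j # us) \<circ> cycle_of_list cs"
proof -
  obtain p q where cs: "cs = p @ j # q" "j \<notin> set p"
    using assms(2) by (meson split_list_first)
  have "cycle_of_list (insert_before j us cs) = cycle_of_list (us @ j # q @ p)"
    using cycle_of_list_append_commute[of p "us @ j # q"] assms
    by (auto simp: cs insert_before_split)
  also have "\<dots> = cycle_of_list (us @ [j]) \<circ> cycle_of_list (j # q @ p)"
    by (rule cycle_of_list_append_Cons)
  also have "cycle_of_list (us @ [j]) = cycle_of_list (j # us)"
    using cycle_of_list_append_commute[of us "[j]"] assms by auto
  also have "cycle_of_list (j # q @ p) = cycle_of_list cs"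
    using cycle_of_list_append_commute[of p "j # q"] assms by (simp add: cs)
  finally show ?thesis .
qed

section \<open>Right-to-left minima\<close>

text \<open>Every entry of \<open>u\<close> is followed by the smaller \<open>m\<close>, and
  \<open>m\<close> is below everything after it; only \<open>v\<close> can contribute further
  minima.\<close>

lemma rl_min_positions_split:
  fixes m :: "'a::linorder"
  assumes "\<forall>x\<in>set u \<union> set v. m < x"
  shows "rl_min_positions (u @ m # v) =
    Suc (length u) # map ((+) (Suc (length u))) (rl_min_positions v)"
proof -
  define k where "k = Suc (length u)"
  define w where "w = u @ m # v"
  define R where "R w = {i \<in> {1..length w}. \<forall>j\<in>{i<..length w}. w ! (i - 1) < w ! (j - 1)}"
    for w :: "'a list"
  have R: "rl_min_positions w = sorted_list_of_set (R w)" for w :: "'a list"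
    by (simp add: rl_min_positions_def R_def)
  have fin: "finite (R w)" for w :: "'a list" by (simp add: R_def)
  have len: "length w = k + length v" by (simp add: w_def k_def)
  have right: "w ! (k + i - 1) = v ! (i - 1)" if "1 \<le> i" for i
    using that by (cases i) (auto simp: w_def k_def nth_append)
  have mid: "w ! (k - 1) = m" by (simp add: w_def k_def)
  have left: "m < w ! (i - 1)" if "1 \<le> i" "i < k" for i
  proof -
    have "i - 1 < length u" using that by (simp add: k_def)
    then show ?thesis using assms by (auto simp: w_def nth_append)
  qed
  have "R w = insert k ((+) k ` R v)"
  proof (intro set_eqI iffI)
    fix i assume i: "i \<in> R w"
    then have *: "1 \<le> i" "i \<le> k + length v"
      "\<And>j. i < j \<Longrightarrow> j \<le> k + length v \<Longrightarrow> w ! (i - 1) < w ! (j - 1)"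
      by (auto simp: R_def len)
    have "k \<le> i" using *(1) *(3)[of k] left[of i] mid by (metis leI le_add1 order.asym)
    then consider "i = k" | a where "i = k + a" "1 \<le> a"
      by (cases "i = k") (auto dest!: le_Suc_ex)
    then show "i \<in> insert k ((+) k ` R v)"
    proof cases
      case 2
      have "v ! (a - 1) < v ! (b - 1)" if "a < b" "b \<le> length v" for b
        using *(3)[of "k + b"] that 2 right[of a] right[of b] by auto
      then have "a \<in> R v" using 2 *(2) by (auto simp: R_def)
      then show ?thesis using 2 by blast
    qed simp
  next
    fix i assume "i \<in> insert k ((+) k ` R v)"
    then consider "i = k" | a where "i = k + a" "a \<in> R v" by blast
    then show "i \<in> R w"
    proof cases
      case 1
      have "m < w ! (j - 1)" if "k < j" "j \<le> k + length v" for j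
      proof -
        obtain b where b: "j = k + b" "1 \<le> b"
          using less_imp_add_positive[OF \<open>k < j\<close>] by (auto simp: Suc_le_eq)
        then have "v ! (b - 1) \<in> set v" using that by auto
        then show ?thesis using right[of b] b assms by auto
      qed
      then show ?thesis using 1 mid by (auto simp: R_def len k_def)
    next
      case 2
      have "w ! (k + a - 1) < w ! (j - 1)" if "k + a < j" "j \<le> k + length v" for j
      proof -
        obtain b where b: "j = k + b" "a < b"
          using less_imp_add_positive[OF \<open>k + a < j\<close>] by (auto simp: add.assoc)
        then show ?thesis using that 2 right[of a] right[of b] by (auto simp: R_def)
      qed
      then show ?thesis using 2 by (auto simp: R_def len)
    qed
  qed
  \<comment> \<open>Positions count from 1, so every shifted position of \<open>v\<close> lies
    strictly after \<open>k\<close>.\<close>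
  moreover have "sorted_list_of_set (insert k ((+) k ` R v)) = k # map ((+) k) (sorted_list_of_set (R v))"
  proof (rule strict_sorted_equal)
    have "a \<ge> 1" if "a \<in> R v" for a using that by (simp add: R_def)
    moreover have "sorted_wrt (<) (map ((+) k) (sorted_list_of_set (R v)))"
      by (simp add: sorted_wrt_map)
    ultimately show "sorted_wrt (<) (k # map ((+) k) (sorted_list_of_set (R v)))"
      using fin[of v] by force
  qed (use fin[of v] in \<open>simp_all del: sorted_list_of_set_insert_remove\<close>)
  ultimately show ?thesis by (simp add: R w_def k_def)
qed

lemma rl_min_blocks_split:
  fixes m :: "'a::linorder"
  assumes "\<forall>x\<in>set u \<union> set v. m < x"
  shows "rl_min_blocks (u @ m # v) = (u @ [m]) # rl_min_blocks v"
proof -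
  let ?k = "Suc (length u)"
  \<comment> \<open>The boundary after \<open>m\<close> is the initial boundary 0 of
    \<open>v\<close>, shifted; so all block limits of \<open>v\<close> move by the same
    amount.\<close>
  have "zip (?k # map ((+) ?k) ps) (map ((+) ?k) ps) =
      map (\<lambda>(a, b). (?k + a, ?k + b)) (zip (0 # ps) ps)" for ps
    using zip_map_map[of "(+) ?k" "0 # ps" "(+) ?k" ps] by simp
  moreover have "drop (?k + a) (take (?k + b) (u @ m # v)) = drop a (take b v)" for a b
    by simp
  ultimately show ?thesis
    by (simp add: rl_min_blocks_def rl_min_positions_split[OF assms] Let_def case_prod_unfold comp_def
        del: add_Suc)
qed

lemma phi_Nil [simp]: "phi [] = id"
  by (simp add: phi_def rl_min_blocks_def rl_min_positions_def)

lemma phi_split: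
  fixes m :: "'a::linorder"
  assumes "\<forall>x\<in>set u \<union> set v. m < x"
  shows "phi (u @ m # v) = cycle_of_list (u @ [m]) \<circ> phi v"
  by (simp add: phi_def rl_min_blocks_split[OF assms])

text \<open>Induction along the recursion \<open>phi_split\<close>: cut at the minimum and continue
  with the suffix to its right.\<close>

lemma distinct_min_split_induct [consumes 1, case_names Nil split]:
  fixes w :: "'a::linorder list"
  assumes "distinct w" "P []"
    and "\<And>u m v. distinct (u @ m # v) \<Longrightarrow> \<forall>x\<in>set u \<union> set v. m < x \<Longrightarrow> P v \<Longrightarrow> P (u @ m # v)"
  shows "P w"
  using assms(1)
proof (induction "length w" arbitrary: w rule: less_induct)
  case less
  show ?case
  proof (cases "w = []")
    case False
    then have "Min (set w) \<in> set w" by simp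
    then obtain u v where w: "w = u @ Min (set w) # v" by (meson split_list)
    define m where "m = Min (set w)"
    have wm: "w = u @ m # v" using w m_def by simp
    have "m < x" if "x \<in> set u \<union> set v" for x
    proof -
      have "m \<le> x" unfolding m_def using that arg_cong[OF wm, of set] by (intro Min_le) auto
      moreover have "m \<noteq> x" using less.prems that unfolding wm by auto
      ultimately show ?thesis by simp
    qed
    moreover have "P v" using less.hyps[of v] less.prems unfolding wm by simp
    ultimately show ?thesis using assms(3)[of u m v] less.prems unfolding wm by blast
  qed (use assms(2) in simp)
qed

lemma phi_permutes:
  fixes w :: "'a::linorder list"
  assumes "distinct w"
  shows "phi w permutes set w"
  using assms
proof (induction rule: distinct_min_split_induct)
  case (split u m v)
  have "cycle_of_list (u @ [m]) permutes set (u @ m # v)"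
    using permutes_subset[OF cycle_permutes, of "u @ [m]"] by auto
  moreover have "phi v permutes set (u @ m # v)"
    by (rule permutes_subset[OF split.IH]) auto
  ultimately show ?case
    using split.hyps permutes_compose by (simp only: phi_split) blast
qed (simp add: id_def[symmetric])

text \<open>Every letter of an increasing word is a right-to-left minimum, so all cycles have length
  one. Serves the initial word of \<open>Phi\<close>.\<close>

lemma phi_sorted:
  assumes "sorted_wrt (<) w"
  shows "phi w = id"
  using assms
proof (induction w)
  case (Cons a w)
  then show ?case using phi_split[of "[]" w a] by simp
qed simp

section \<open>Effect of an insertion on \<open>phi\<close>\<close>

lemma set_insert_before: "set (insert_before j us w) = set us \<union> set w"
  using takeWhile_dropWhile_id[of "\<lambda>x. x \<noteq> j" w] unfolding insert_before_def
  by (metis set_append sup.left_commute)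

lemma distinct_insert_before:
  assumes "distinct w" "distinct us" "set us \<inter> set w = {}"
  shows "distinct (insert_before j us w)"
proof -
  have "distinct (takeWhile (\<lambda>x. x \<noteq> j) w @ dropWhile (\<lambda>x. x \<noteq> j) w)"
    using assms(1) by simp
  then show ?thesis
    unfolding insert_before_def using assms
    unfolding distinct_append by (auto dest: set_takeWhileD set_dropWhileD)
qed

lemma insert_before_append:
  "j \<in> set u \<Longrightarrow> insert_before j us (u @ v) = insert_before j us u @ v"
  "j \<notin> set u \<Longrightarrow> insert_before j us (u @ v) = u @ insert_before j us v"
  by (auto simp: insert_before_def takeWhile_append1 dropWhile_append1
      takeWhile_append2 dropWhile_append2 takeWhile_append dropWhile_append)

text \<open>Letters larger than the letter they precede create and destroy no right-to-left minimum.\<close>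

lemma phi_insert_before:
  fixes w :: "'a::linorder list"
  assumes "distinct w" "j \<in> set w" "distinct us" "set us \<inter> set w = {}" "\<forall>x\<in>set us. j < x"
  shows "phi (insert_before j us w) = cycle_of_list (j # us) \<circ> phi w"
  using assms
proof (induction rule: distinct_min_split_induct)
  case (split u m v)
  \<comment> \<open>As the minimum of the old word, \<open>m\<close> is at most \<open>j\<close>; it
    remains the minimum after the insertion.\<close>
  have less: "\<forall>x\<in>set us. m < x" using split by (auto intro: less_trans)
  show ?case
  proof (cases "j \<in> set (u @ [m])")
    case True
    \<comment> \<open>Insertion into the first block leaves \<open>m\<close> at its end, even for
      \<open>j = m\<close>; \<open>u'\<close> is what then precedes \<open>m\<close>.\<close>
    define u' where "u' = (if j = m then u @ us else insert_before j us u)"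
    have u': "insert_before j us (u @ [m]) = u' @ [m]"
    proof (cases "j = m")
      case True
      have "m \<notin> set u" using split.hyps by auto
      then show ?thesis using True by (simp add: u'_def insert_before_split)
    next
      case False
      then have "j \<in> set u" using \<open>j \<in> set (u @ [m])\<close> by simp
      then show ?thesis using False by (simp add: u'_def insert_before_append)
    qed
    have "set u' \<subseteq> set u \<union> set us" by (auto simp: u'_def set_insert_before)
    then have "\<forall>x\<in>set u' \<union> set v. m < x" using split.hyps less by blast
    then have "phi (u' @ m # v) = cycle_of_list (u' @ [m]) \<circ> phi v" by (rule phi_split)
    moreover have "insert_before j us (u @ m # v) = u' @ m # v"
      using insert_before_append(1)[OF True, of us v] u' by simp
    moreover have "cycle_of_list (u' @ [m]) = cycle_of_list (j # us) \<circ> cycle_of_list (u @ [m])"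
      unfolding u'[symmetric] using split True by (intro cycle_of_list_insert_before) auto
    ultimately show ?thesis using split.hyps by (simp add: phi_split comp_assoc)
  next
    case False
    then have v: "j \<in> set v" using split.prems by auto
    have "insert_before j us (u @ m # v) = u @ m # insert_before j us v"
      using insert_before_append(2)[OF False, of us v] by simp
    moreover have "\<forall>x\<in>set u \<union> set (insert_before j us v). m < x"
      using split.hyps less by (auto simp: set_insert_before)
    moreover have "phi (insert_before j us v) = cycle_of_list (j # us) \<circ> phi v"
      using split.prems v by (intro split.IH) auto
    ultimately have "phi (insert_before j us (u @ m # v)) =
        cycle_of_list (u @ [m]) \<circ> (cycle_of_list (j # us) \<circ> phi v)"
      by (simp only: phi_split)
    \<comment> \<open>The entries of \<open>j # us\<close> lie in \<open>v\<close> or are new, hence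
      outside \<open>u @ [m]\<close>: disjoint cycles commute.\<close>
    also have "\<dots> = (cycle_of_list (j # us) \<circ> cycle_of_list (u @ [m])) \<circ> phi v"
      unfolding comp_assoc[symmetric] using split False v
      by (subst cycles_commute) auto
    finally show ?thesis using split.hyps by (simp add: phi_split comp_assoc)
  qed
qed simp

section \<open>Arrows of a permutation tableau\<close>

locale perm_tableau =
  fixes T :: tableau and n :: nat
  assumes T: "T \<in> PT n"
begin

lemma labels: "rows T \<union> cols T = {1..n}" "rows T \<inter> cols T = {}"
  and ones_cells: "ones T \<subseteq> cells T"
  and ex_one: "c \<in> cols T \<Longrightarrow> \<exists>r. (r, c) \<in> ones T"
  using T by (auto simp: PT_def)

lemma zero_left:
  assumes "(r, c) \<in> zeros T" "(r', c) \<in> ones T" "r' < r" "(r, c') \<in> ones T"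
  shows "c' \<le> c"
proof -
  have "\<forall>(r, c)\<in>zeros T. \<not> ((\<exists>r'<r. (r', c) \<in> ones T) \<and> (\<exists>c'>c. (r, c') \<in> ones T))"
    using T by (simp add: PT_def)
  then show ?thesis using assms leI by blast
qed

lemma finite_labels [simp]: "finite (rows T)" "finite (cols T)"
  using labels(1) finite_Un[of "rows T" "cols T"] by simp_all

lemma alt_rep_cell: "alt_rep T r c = Some a \<Longrightarrow> (r, c) \<in> cells T"
  using ones_cells by (auto simp: alt_rep_def restricted_def zeros_def split: if_splits)

lemma Up_iff: "alt_rep T r c = Some Up_Arrow \<longleftrightarrow> (r, c) \<in> ones T \<and> (\<forall>r'<r. (r', c) \<notin> ones T)"
  by (simp add: alt_rep_def)

text \<open>A restricted 0 is not a 1, so the up-arrow case of \<open>alt_rep\<close> never takes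
  precedence over this one.\<close>

lemma Left_iff: "alt_rep T r c = Some Left_Arrow \<longleftrightarrow> (r, c) \<in> restricted T \<and> (\<forall>c'<c. (r, c') \<notin> restricted T)"
  by (auto simp: alt_rep_def restricted_def zeros_def)

lemma ex1_Up:
  assumes "c \<in> cols T"
  shows "\<exists>!r. alt_rep T r c = Some Up_Arrow"
proof -
  obtain r where "(r, c) \<in> ones T" using ex_one assms by blast
  then have "alt_rep T (LEAST r. (r, c) \<in> ones T) c = Some Up_Arrow"
    using LeastI[of "\<lambda>r. (r, c) \<in> ones T"] not_less_Least by (auto simp: Up_iff)
  then show ?thesis unfolding Up_iff by (intro ex_ex1I) (blast, meson linorder_neqE_nat)
qed

text \<open>The restricted 0 has some 1 above it, and the topmost 1 is at least as high.\<close>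

lemma Up_above_Left:
  assumes "alt_rep T j c = Some Up_Arrow" "alt_rep T i c = Some Left_Arrow"
  shows "j < i"
proof -
  obtain r where "r < i" "(r, c) \<in> ones T" "(i, c) \<notin> ones T"
    using assms(2) by (auto simp: Left_iff restricted_def zeros_def)
  then show ?thesis using assms(1) unfolding Up_iff by (metis linorder_neqE order.strict_trans)
qed

lemma Left_unique:
  assumes "alt_rep T r c = Some Left_Arrow" "alt_rep T r c' = Some Left_Arrow"
  shows "c = c'"
  using assms unfolding Left_iff by (meson linorder_neqE_nat)

text \<open>A 1 to the left of a restricted 0 would violate the second tableau condition.
  Consequently the row of an up-arrow is already in the word when the column of that arrow is
  inserted.\<close>

lemma Up_right_of_Left:
  assumes "alt_rep T r c = Some Left_Arrow" "alt_rep T r c' = Some Up_Arrow"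
  shows "c' < c"
proof -
  obtain r' where "r' < r" "(r', c) \<in> ones T" "(r, c) \<in> zeros T"
    using assms(1) by (auto simp: Left_iff restricted_def)
  then have "c' \<le> c" using assms(2) zero_left unfolding Up_iff by blast
  moreover have "c' \<noteq> c" using assms by auto
  ultimately show ?thesis by simp
qed

lemma unrestricted_iff: "r \<in> unrestricted_rows T \<longleftrightarrow> r \<in> rows T \<and> (\<forall>c. alt_rep T r c \<noteq> Some Left_Arrow)"
proof -
  have "alt_rep T r (LEAST c. (r, c) \<in> restricted T) = Some Left_Arrow" if "(r, c) \<in> restricted T" for c
    using LeastI[of "\<lambda>c. (r, c) \<in> restricted T", OF that] not_less_Least by (auto simp: Left_iff)
  moreover have "(r, c) \<in> restricted T" if "alt_rep T r c = Some Left_Arrow" for c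
    using that by (simp add: Left_iff)
  ultimately show ?thesis unfolding unrestricted_rows_def by blast
qed

section \<open>Paths\<close>

lemma travel_South_exit:
  assumes "\<And>r'. r < r' \<Longrightarrow> alt_rep T r' c = None"
  shows "travel T South r c = c"
  using assms
proof (induction "c - r" arbitrary: r rule: less_induct)
  case less
  define R where "R = {r'. (r', c) \<in> cells T \<and> r < r'}"
  show ?case
  proof (cases "R = {}")
    case True
    then show ?thesis by (simp add: travel.simps R_def Let_def)
  next
    case False
    have "finite R" by (rule finite_subset[of _ "{..<c}"]) (auto simp: R_def cells_def)
    then have "Min R \<in> R" using False by simp
    then have "r < Min R" "Min R < c" by (auto simp: R_def cells_def)
    then have "travel T South (Min R) c = c" using less by simp
    then show ?thesis using False less.prems \<open>r < Min R\<close> by (subst travel.simps) (simp add: R_def Let_def)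
  qed
qed

lemma travel_South_turn:
  assumes "alt_rep T r' c = Some a" "r < r'" "\<And>i. r < i \<Longrightarrow> i < r' \<Longrightarrow> alt_rep T i c = None"
  shows "travel T South r c = travel T East r' c"
  using assms(2,3)
proof (induction "c - r" arbitrary: r rule: less_induct)
  case less
  define R where "R = {r'. (r', c) \<in> cells T \<and> r < r'}"
  have r': "r' \<in> R" using alt_rep_cell[OF assms(1)] less.prems by (simp add: R_def)
  have "finite R" by (rule finite_subset[of _ "{..<c}"]) (auto simp: R_def cells_def)
  then have "Min R \<in> R" "Min R \<le> r'" using r' Min_in[of R] by (blast, simp)
  then have min: "r < Min R" "Min R < c" "Min R \<le> r'" by (auto simp: R_def cells_def)
  have step: "travel T South r c =
      travel T (if alt_rep T (Min R) c = None then South else East) (Min R) c"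
    using r' unfolding R_def by (subst travel.simps) (auto simp: Let_def)
  show ?case
  proof (cases "Min R = r'")
    case True
    then show ?thesis using step assms(1) by simp
  next
    case False
    then have "alt_rep T (Min R) c = None" using min less.prems by simp
    moreover have "travel T South (Min R) c = travel T East r' c"
      using min False less.prems by (intro less.hyps) auto
    ultimately show ?thesis using step by simp
  qed
qed

text \<open>Together with \<open>travel_East_cell\<close>, follows a path one label at a time:
  departing from \<open>Suc b\<close>, the next label to consider is \<open>b\<close>.\<close>

lemma travel_East_skip:
  assumes "(r, b) \<notin> cells T"
  shows "travel T East r (Suc b) = travel T East r b"
proof -
  have "{c'. (r, c') \<in> cells T \<and> c' < Suc b} = {c'. (r, c') \<in> cells T \<and> c' < b}"
    using assms by (auto simp: less_Suc_eq)
  then show ?thesis by (simp add: travel.simps(1)[of T r b] travel.simps(1)[of T r "Suc b"])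
qed

lemma travel_East_cell:
  assumes "(r, b) \<in> cells T"
  shows "travel T East r (Suc b) = travel T (if alt_rep T r b = None then East else South) r b"
proof -
  let ?C = "{c'. (r, c') \<in> cells T \<and> c' < Suc b}"
  have "finite ?C" by (rule finite_subset[of _ "{..b}"]) auto
  then have "Max ?C = b" using assms by (intro Max_eqI) auto
  then show ?thesis using assms by (subst travel.simps) (auto simp: Let_def)
qed

text \<open>With \<open>c\<close> appended, this is the cycle by which Column \<open>c\<close>
  changes both maps.\<close>

definition column_arrows :: "nat \<Rightarrow> nat list" where
  "column_arrows c = (THE j. alt_rep T j c = Some Up_Arrow) #
     sorted_list_of_set {i \<in> rows T. alt_rep T i c = Some Left_Arrow}"

lemma column_arrows:
  assumes "c \<in> cols T"
  shows "sorted_wrt (<) (column_arrows c @ [c])"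
    and "set (column_arrows c) = {r. alt_rep T r c \<noteq> None}"
    and "alt_rep T (hd (column_arrows c)) c = Some Up_Arrow"
proof -
  let ?L = "{i \<in> rows T. alt_rep T i c = Some Left_Arrow}"
  define j where "j = (THE j. alt_rep T j c = Some Up_Arrow)"
  have j: "alt_rep T j c = Some Up_Arrow"
    unfolding j_def using ex1_Up[OF assms] by (rule theI')
  then show "alt_rep T (hd (column_arrows c)) c = Some Up_Arrow"
    by (simp add: column_arrows_def j_def)
  have "alt_rep T r c \<noteq> None \<longleftrightarrow> r = j \<or> r \<in> ?L" for r
  proof (cases "alt_rep T r c")
    case (Some a)
    then show ?thesis
      using j ex1_Up[OF assms] alt_rep_cell[OF Some] by (cases a) (auto simp: cells_def)
  qed (use j in auto)
  then show set: "set (column_arrows c) = {r. alt_rep T r c \<noteq> None}"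
    by (auto simp: column_arrows_def j_def)
  have "\<forall>r\<in>set (column_arrows c). r < c"
    unfolding set using alt_rep_cell by (auto simp: cells_def)
  moreover have "\<forall>i\<in>?L. j < i" using Up_above_Left[OF j] by blast
  ultimately show "sorted_wrt (<) (column_arrows c @ [c])"
    by (auto simp: column_arrows_def j_def[symmetric] sorted_wrt_append)
qed

lemma insert_column_eq:
  "insert_column T c w = insert_before (hd (column_arrows c)) (tl (column_arrows c) @ [c]) w"
  by (simp add: insert_column_def column_arrows_def)

text \<open>For a path that has crossed all columns with labels at least \<open>c\<close> and is about to leave
  through the label \<open>x\<close> if it meets no further arrow.\<close>

definition continue :: "nat \<Rightarrow> nat \<Rightarrow> nat" where
  "continue c x = (if x \<in> rows T then travel T East x c else x)"

text \<open>No arrow lies strictly between consecutive entries. Here \<open>y\<close> is the row of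
  the next arrow or, below the last arrow, \<open>c\<close> itself; so turning east and leaving at
  the bottom are treated together.\<close>

lemma travel_South_next:
  assumes "c \<in> cols T" "xs @ x # y # ys = column_arrows c @ [c]"
  shows "travel T South x c = continue c y"
proof -
  have sorted: "sorted_wrt (<) (xs @ x # y # ys)"
    using column_arrows(1)[OF assms(1)] by (simp add: assms(2))
  have set: "insert c {r. alt_rep T r c \<noteq> None} = set (xs @ x # y # ys)"
    unfolding assms(2) using column_arrows(2)[OF assms(1)] by auto
  have gap: "alt_rep T i c = None" if "x < i" "i < y" for i
  proof (rule ccontr)
    assume "alt_rep T i c \<noteq> None"
    then have "i \<in> set (xs @ x # y # ys)" using set by blast
    then show False using sorted that by (auto simp: sorted_wrt_append)
  qed
  have "x < y" using sorted by (auto simp: sorted_wrt_append)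
  show ?thesis
  proof (cases "y = c")
    case True
    \<comment> \<open>Cells of Column \<open>c\<close> have row labels below \<open>c\<close>, so an
      arrow-free gap up to \<open>c\<close> means that no further arrow follows.\<close>
    have "alt_rep T i c = None" if "x < i" for i
      using gap[OF that] alt_rep_cell[of i c] True by (cases "alt_rep T i c") (auto simp: cells_def)
    moreover have "c \<notin> rows T" using assms(1) labels(2) by blast
    ultimately show ?thesis using True by (simp add: continue_def travel_South_exit)
  next
    case False
    then obtain a where a: "alt_rep T y c = Some a" using set by auto
    then have "y \<in> rows T" using alt_rep_cell by (auto simp: cells_def)
    then show ?thesis using travel_South_turn[OF a \<open>x < y\<close> gap] by (simp add: continue_def)
  qed
qed

lemma travel_South_enter:
  assumes "c \<in> cols T"
  shows "travel T South 0 c = continue c (hd (column_arrows c))"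
proof -
  let ?j = "hd (column_arrows c)"
  have a: "alt_rep T ?j c = Some Up_Arrow" by (rule column_arrows(3)[OF assms])
  then have row: "?j \<in> rows T" using alt_rep_cell by (auto simp: cells_def)
  then have pos: "0 < ?j" using labels(1) by (metis UnI1 atLeastAtMost_iff less_eq_Suc_le One_nat_def)
  have "alt_rep T i c = None" if "i < ?j" for i
  proof (rule ccontr)
    assume "alt_rep T i c \<noteq> None"
    then have "i \<in> set (column_arrows c)" using column_arrows(2)[OF assms] by blast
    then show False using column_arrows(1)[OF assms] that by (cases "column_arrows c") auto
  qed
  then show ?thesis using travel_South_turn[OF a pos] row by (simp add: continue_def)
qed

text \<open>At an arrow the path turns south and moves to the next entry of the cycle; all other
  labels are fixed by the cycle and their paths go straight on. The path entering at the top of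
  Column \<open>c\<close> is left to \<open>travel_South_enter\<close>.\<close>

lemma continue_Suc:
  assumes "c \<in> cols T" "x \<noteq> c"
  shows "continue (Suc c) x = continue c (cycle_of_list (column_arrows c @ [c]) x)"
proof (cases "x \<in> set (column_arrows c)")
  case True
  then obtain xs zs where split: "column_arrows c = xs @ x # zs" by (meson split_list)
  obtain y ys where "zs @ [c] = y # ys" by (cases "zs @ [c]") auto
  then have eq: "xs @ x # y # ys = column_arrows c @ [c]" using split by simp
  have "distinct (column_arrows c @ [c])"
    using column_arrows(1)[OF assms(1)] by (simp add: strict_sorted_iff)
  then have "cycle_of_list (column_arrows c @ [c]) x = y"
    using cycle_of_list_next[of xs x y ys] unfolding eq by blast
  moreover obtain a where a: "alt_rep T x c = Some a"
    using True column_arrows(2)[OF assms(1)] by auto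
  then have "(x, c) \<in> cells T" by (rule alt_rep_cell)
  then have "continue (Suc c) x = travel T South x c"
    using a by (simp add: continue_def travel_East_cell cells_def)
  ultimately show ?thesis using travel_South_next[OF assms(1) eq] by simp
next
  case False
  then have "cycle_of_list (column_arrows c @ [c]) x = x"
    using assms(2) by (intro id_outside_supp) auto
  moreover have "alt_rep T x c = None" using False column_arrows(2)[OF assms(1)] by auto
  then have "continue (Suc c) x = continue c x"
    by (cases "(x, c) \<in> cells T") (auto simp: continue_def travel_East_cell travel_East_skip)
  ultimately show ?thesis by simp
qed

section \<open>Insertion of the columns from left to right\<close>

text \<open>Labels decrease from left to right, so lowering \<open>c\<close> inserts further
  columns: \<open>Suc n\<close> gives the initial word and 0 gives \<open>Phi T\<close>.\<close>

definition partial_word :: "nat \<Rightarrow> nat list" where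
  "partial_word c = fold (insert_column T) (rev (sorted_list_of_set {c' \<in> cols T. c \<le> c'}))
     (sorted_list_of_set (unrestricted_rows T))"

text \<open>The letters of \<open>partial_word c\<close>. A restricted row enters with the column of
  its only left-arrow, so a row is present once no left-arrow of it is still to come.\<close>

definition partial_labels :: "nat \<Rightarrow> nat set" where
  "partial_labels c = {r \<in> rows T. \<forall>c'<c. alt_rep T r c' \<noteq> Some Left_Arrow} \<union> {c' \<in> cols T. c \<le> c'}"

lemma partial_word_step:
  "partial_word c = (if c \<in> cols T then insert_column T c (partial_word (Suc c)) else partial_word (Suc c))"
proof (cases "c \<in> cols T")
  case True
  let ?A = "{c' \<in> cols T. c \<le> c'}"
  have "Min ?A = c" using True by (intro Min_eqI) auto
  moreover have "?A - {c} = {c' \<in> cols T. Suc c \<le> c'}" by auto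
  ultimately have "sorted_list_of_set ?A = c # sorted_list_of_set {c' \<in> cols T. Suc c \<le> c'}"
    using True by (subst sorted_list_of_set_nonempty) auto
  then show ?thesis using True by (simp add: partial_word_def)
next
  case False
  then have "{c' \<in> cols T. c \<le> c'} = {c' \<in> cols T. Suc c \<le> c'}"
    using le_eq_less_or_eq by auto
  then show ?thesis using False by (simp add: partial_word_def)
qed

text \<open>The first claim rests on the uniqueness of the left-arrow in a row, the last on
  \<open>Up_right_of_Left\<close>. The second and third are what \<open>phi_insert_before\<close>
  requires: new letters are absent and \<open>j\<close> is present.\<close>

lemma partial_labels_step:
  assumes "c \<in> cols T"
  shows "partial_labels c = insert c (partial_labels (Suc c) \<union> set (tl (column_arrows c)))"
    and "insert c (set (tl (column_arrows c))) \<inter> partial_labels (Suc c) = {}"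
    and "hd (column_arrows c) \<in> partial_labels (Suc c)"
proof -
  have tl: "set (tl (column_arrows c)) = {i \<in> rows T. alt_rep T i c = Some Left_Arrow}"
    by (simp add: column_arrows_def)
  have "r \<in> partial_labels c \<longleftrightarrow> r \<in> partial_labels (Suc c) \<or> alt_rep T r c = Some Left_Arrow"
    if "r \<in> rows T" for r
    using that labels(2) Left_unique[of r c] unfolding partial_labels_def
    by (auto simp: less_Suc_eq)
  moreover have "r \<in> partial_labels c \<longleftrightarrow> r \<in> partial_labels (Suc c) \<or> r = c"
    if "r \<notin> rows T" for r
    using that assms unfolding partial_labels_def by auto
  moreover have "c \<notin> rows T" using assms labels(2) by blast
  ultimately show "partial_labels c = insert c (partial_labels (Suc c) \<union> set (tl (column_arrows c)))"
    unfolding tl partial_labels_def using assms by auto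
  show "insert c (set (tl (column_arrows c))) \<inter> partial_labels (Suc c) = {}"
    unfolding tl partial_labels_def using labels(2) assms by auto
  have up: "alt_rep T (hd (column_arrows c)) c = Some Up_Arrow" by (rule column_arrows(3)[OF assms])
  then have "hd (column_arrows c) \<in> rows T" using alt_rep_cell by (auto simp: cells_def)
  then show "hd (column_arrows c) \<in> partial_labels (Suc c)"
    using Up_right_of_Left[OF _ up] unfolding partial_labels_def by force
qed

lemma partial_labels_skip: "c \<notin> cols T \<Longrightarrow> partial_labels c = partial_labels (Suc c)"
proof -
  assume "c \<notin> cols T"
  then have "alt_rep T r c \<noteq> Some Left_Arrow" for r using alt_rep_cell by (auto simp: cells_def)
  then show ?thesis using \<open>c \<notin> cols T\<close> unfolding partial_labels_def
    by (auto simp: less_Suc_eq Suc_le_eq le_less)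
qed

text \<open>Downward induction from \<open>Suc n\<close>. The two maps are compared on the paths
  that have entered so far, those of all rows and of the inserted columns.\<close>

lemma partial_word_invariant:
  assumes "c \<le> Suc n"
  shows "distinct (partial_word c) \<and> set (partial_word c) = partial_labels c \<and>
    (\<forall>i \<in> rows T \<union> {c' \<in> cols T. c \<le> c'}. zigzag_alt T i = continue c (phi (partial_word c) i))"
  using assms
proof (induction c rule: inc_induct)
  case base
  have le_n: "c \<le> n" if "c \<in> cols T" for c
    using that labels(1) by (metis UnI2 atLeastAtMost_iff)
  have none: "{c' \<in> cols T. Suc n \<le> c'} = {}" using le_n by fastforce
  have fin: "finite (unrestricted_rows T)" by (simp add: unrestricted_rows_def)
  have w: "partial_word (Suc n) = sorted_list_of_set (unrestricted_rows T)"
    by (simp only: partial_word_def none) simp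
  have "c \<le> n" if "alt_rep T r c = Some a" for r c a
    using alt_rep_cell[OF that] le_n by (auto simp: cells_def)
  then have set: "unrestricted_rows T = partial_labels (Suc n)"
    using none by (fastforce simp: partial_labels_def unrestricted_iff less_Suc_eq_le)
  \<comment> \<open>Thus \<open>len T = n\<close>, and row paths depart from column
    \<open>Suc n\<close>, as in \<open>continue (Suc n)\<close>.\<close>
  have "card (rows T) + card (cols T) = n"
    using card_Un_disjoint[of "rows T" "cols T"] labels by simp
  then have "zigzag_alt T i = continue (Suc n) (phi (partial_word (Suc n)) i)" if "i \<in> rows T" for i
    using that by (simp add: w phi_sorted zigzag_alt_def continue_def len_def)
  then show ?case using fin none set w by simp blast
next
  case (step c)
  define w where "w = partial_word (Suc c)"
  have IH: "distinct w" "set w = partial_labels (Suc c)"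
    "\<And>i. i \<in> rows T \<union> {c' \<in> cols T. Suc c \<le> c'} \<Longrightarrow> zigzag_alt T i = continue (Suc c) (phi w i)"
    using step.IH by (auto simp: w_def)
  show ?case
  proof (cases "c \<in> cols T")
    case True
    let ?j = "hd (column_arrows c)" and ?us = "tl (column_arrows c) @ [c]"
    have arrows: "column_arrows c = ?j # tl (column_arrows c)" by (simp add: column_arrows_def)
    have sorted: "sorted_wrt (<) (?j # ?us)"
      using column_arrows(1)[OF True] by (metis arrows append_Cons)
    have word: "partial_word c = insert_before ?j ?us w"
      using True by (subst partial_word_step) (simp add: w_def insert_column_eq)
    have us: "distinct ?us" "set ?us \<inter> set w = {}" "\<forall>x\<in>set ?us. ?j < x" "?j \<in> set w"
      using sorted[unfolded strict_sorted_iff, THEN conjunct2] sorted partial_labels_step[OF True] IH(2) by auto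
    have phi: "phi (partial_word c) = cycle_of_list (column_arrows c @ [c]) \<circ> phi w"
      unfolding word using phi_insert_before[OF IH(1) us(4) us(1-3)] arrows by (metis append_Cons)
    \<comment> \<open>\<open>c\<close> is not yet a letter of \<open>w\<close>. Being fixed by the
      permutation \<open>phi w\<close>, it is not the image of any other label either.\<close>
    have fix_c: "phi w c = c"
      using phi_permutes[OF IH(1)] us(2) by (auto simp: permutes_def)
    have "zigzag_alt T i = continue c (phi (partial_word c) i)"
      if "i \<in> rows T \<union> {c' \<in> cols T. c \<le> c'}" for i
    proof (cases "i = c")
      case i: True
      \<comment> \<open>The entering path meets the up-arrow first, just as the cycle sends its last
        entry to its first.\<close>
      have "cycle_of_list (?j # tl (column_arrows c) @ [c]) c = ?j"
        using sorted[unfolded strict_sorted_iff, THEN conjunct2] by (intro cycle_of_list_last) simp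
      then have "phi (partial_word c) c = ?j"
        using arrows by (metis append_Cons comp_apply fix_c phi)
      moreover have "c \<notin> rows T" using True labels(2) by blast
      ultimately show ?thesis
        using True travel_South_enter[OF True] by (simp add: i zigzag_alt_def)
    next
      case False
      then have "zigzag_alt T i = continue (Suc c) (phi w i)" using that by (intro IH(3)) auto
      moreover have "phi w i \<noteq> c"
        using False fix_c permutes_inj[OF phi_permutes[OF IH(1)]] by (metis injD)
      ultimately show ?thesis using continue_Suc[OF True] by (simp add: phi)
    qed
    moreover have "set (partial_word c) = partial_labels c"
      using partial_labels_step(1)[OF True] IH(2) by (auto simp: word set_insert_before)
    moreover have "distinct (partial_word c)"
      unfolding word using IH(1) us(1,2) by (rule distinct_insert_before)
    ultimately show ?thesis by blast
  next
    case False
    have "continue (Suc c) x = continue c x" for x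
      using False by (auto simp: continue_def travel_East_skip cells_def)
    moreover have "{c' \<in> cols T. c \<le> c'} = {c' \<in> cols T. Suc c \<le> c'}"
      using False le_eq_less_or_eq by auto
    moreover have "partial_word c = w" using False by (subst partial_word_step) (simp add: w_def)
    ultimately show ?thesis
      using IH partial_labels_skip[OF False] by simp
  qed
qed

lemma Phi_eq: "Phi T = partial_word 0"
  by (simp add: Phi_def partial_word_def)

lemma Phi_distinct: "distinct (Phi T)"
  and set_Phi: "set (Phi T) = {1..n}"
  and zigzag_alt_eq: "zigzag_alt T = phi (Phi T)"
proof -
  have inv: "distinct (Phi T)" "set (Phi T) = partial_labels 0"
    "\<And>i. i \<in> rows T \<union> cols T \<Longrightarrow> zigzag_alt T i = continue 0 (phi (Phi T) i)"
    using partial_word_invariant[of 0] by (auto simp: Phi_eq)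
  then show "distinct (Phi T)" by simp
  show set: "set (Phi T) = {1..n}"
    using inv(2) labels(1) by (simp add: partial_labels_def)
  \<comment> \<open>No column has a label below 0, so no cell remains to be crossed.\<close>
  have continue: "continue 0 x = x" for x by (simp add: continue_def travel.simps)
  show "zigzag_alt T = phi (Phi T)"
  proof
    fix i
    show "zigzag_alt T i = phi (Phi T) i"
    proof (cases "i \<in> {1..n}")
      case True
      then show ?thesis using inv(3) labels(1) continue by auto
    next
      case False
      then have "i \<notin> rows T" "i \<notin> cols T" using labels(1) by blast+
      moreover have "phi (Phi T) i = i"
        using False phi_permutes[OF inv(1)] set by (auto simp: permutes_def)
      ultimately show ?thesis by (simp add: zigzag_alt_def)
    qed
  qed
qed

end

theorem theorem5p1:
  fixes n :: nat and T :: tableau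
  assumes "n \<ge> 1" and "T \<in> PT n"
  shows "Phi T \<in> permutations_of_set {1..n} \<and>
         zigzag_alt T permutes {1..n} \<and>
         zigzag_alt T = phi (Phi T)"
proof -
  interpret perm_tableau T n using assms(2) by unfold_locales
  show ?thesis
    using Phi_distinct set_Phi zigzag_alt_eq phi_permutes[OF Phi_distinct]
    by (simp add: permutations_of_set_def)
qed

end
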